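(* Let $0 < \alpha \leq 1/7$ and let $\mathscr{C}$ be a spherical $\{\alpha, -\alpha\}$-code in $\mathbb{R}^r$ with $|\mathscr{C}| \geq \max\left(\binom{1/\alpha^2 - 1}{2},\; r + \frac{1}{16\alpha^4} + \frac{1}{4\alpha^2} + 1 \right)$. If the largest eigenvalue $\lambda_1$ of the Gram matrix $M = M_{\mathscr{C}}$ satisfies $\lambda_1 > \frac{1-\alpha^2}{2\alpha^2}$ and has a corresponding eigenvector $x$ with no negative coordinates, then the maximum degree of the corresponding graph $G = G_{\mathscr{C}}$ satisfies \[ \Delta_G \leq \left( \frac{1-\alpha}{2 \alpha} \right)^2. \]
   Context: A spherical $\{\alpha,-\alpha\}$-code in $\mathbb{R}^r$ is a finite set $\mathscr{C}$ of unit vectors in $\mathbb{R}^r$ with $\langle u, v\rangle \in \{\alpha,-\alpha\}$ for all $u \neq v \in \mathscr{C}$. Its Gram matrix $M_{\mathscr{C}} \in \mathbb{R}^{\mathscr{C}\times\mathscr{C}}$ has entries $M_{\mathscr{C}}(u,v) = \langle u, v\rangle$. The corresponding graph $G_{\mathscr{C}}$ has vertex set $\mathscr{C}$, with $uv$ an edge if and only if $\langle u,v\rangle = -\alpha$. $\Delta_G$ is the maximum degree of $G$. For real $y$, $\binom{y}{2} = y(y-1)/2$. *)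

theory Defs
  imports "HOL-Analysis.Analysis"
begin

definition spherical_code :: "real \<Rightarrow> 'a::real_inner set \<Rightarrow> bool" where
  "spherical_code \<alpha> C \<longleftrightarrow>
     finite C \<and> (\<forall>u\<in>C. norm u = 1) \<and>
     (\<forall>u\<in>C. \<forall>v\<in>C. u \<noteq> v \<longrightarrow> u \<bullet> v \<in> {\<alpha>, - \<alpha>})"

(* A real matrix whose rows and columns are indexed by a finite set I is a binary
   function and a vector in R^I a unary function; only their values on I matter.  In
   particular an eigenvector has to be nonzero somewhere on I. *)

definition eigenvector_on ::
    "'i set \<Rightarrow> ('i \<Rightarrow> 'i \<Rightarrow> real) \<Rightarrow> real \<Rightarrow> ('i \<Rightarrow> real) \<Rightarrow> bool" where
  "eigenvector_on I M \<mu> x \<longleftrightarrow>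
     (\<exists>i\<in>I. x i \<noteq> 0) \<and> (\<forall>i\<in>I. (\<Sum>j\<in>I. M i j * x j) = \<mu> * x i)"

definition eigenvalue_on :: "'i set \<Rightarrow> ('i \<Rightarrow> 'i \<Rightarrow> real) \<Rightarrow> real \<Rightarrow> bool" where
  "eigenvalue_on I M \<mu> \<longleftrightarrow> (\<exists>x. eigenvector_on I M \<mu> x)"

definition largest_eigenvalue_on :: "'i set \<Rightarrow> ('i \<Rightarrow> 'i \<Rightarrow> real) \<Rightarrow> real \<Rightarrow> bool" where
  "largest_eigenvalue_on I M \<mu> \<longleftrightarrow>
     eigenvalue_on I M \<mu> \<and> (\<forall>\<nu>. eigenvalue_on I M \<nu> \<longrightarrow> \<nu> \<le> \<mu>)"

(* To be read as a matrix indexed by the code under consideration. *)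
definition gram_matrix :: "'a::real_inner \<Rightarrow> 'a \<Rightarrow> real" where
  "gram_matrix u v = u \<bullet> v"

(* A graph is a pair of a vertex set and a set of two-element edges. *)
type_synonym 'v graph = "'v set \<times> 'v set set"

definition code_graph :: "real \<Rightarrow> 'a::real_inner set \<Rightarrow> 'a graph" where
  "code_graph \<alpha> C = (C, {{u, v} | u v. u \<in> C \<and> v \<in> C \<and> u \<noteq> v \<and> u \<bullet> v = - \<alpha>})"

definition graph_degree :: "'v graph \<Rightarrow> 'v \<Rightarrow> nat" where
  "graph_degree G v = card {e \<in> snd G. v \<in> e}"

(* Meaningful for a finite graph with at least one vertex. *)
definition max_degree :: "'v graph \<Rightarrow> nat" where
  "max_degree G = Max (graph_degree G ` fst G)"

end

theory Submission imports Defs begin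

text \<open>Normalise the eigenvector \<open>x\<close> and put \<open>V = \<Sum> x\<^sub>u u\<close>. Projecting the matrices
  \<open>V w\<^sup>T + w V\<^sup>T\<close> onto the span of the matrices \<open>u u\<^sup>T\<close> bounds every entry of \<open>x\<close> from below.
  For a nonnegative combination \<open>Z\<close> of a vertex and some of its neighbours, the Cauchy-Schwarz
  inequality \<open>(Z \<bullet> V)\<^sup>2 \<le> \<mu> (Z \<bullet> Z)\<close> then limits the number of these neighbours, first to
  \<open>3 / (8 \<alpha>\<^sup>2)\<close> and, since bounded degrees improve the lower bound on the entries, to
  \<open>1 / (4 \<alpha>\<^sup>2)\<close>. Hence a ball of radius 2 around a vertex \<open>w\<close> of maximum degree leaves more than
  \<open>r\<close> vectors outside, and these satisfy a linear dependence. Let \<open>Y\<close> be the positive part of this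
  dependence. If \<open>w\<close> had degree \<open>d > ((1 - \<alpha>) / (2 \<alpha>))\<^sup>2\<close>, a suitable combination of \<open>Y\<close> and
  \<open>\<surd>d w + \<Sum>\<^bsub>u ~ w\<^esub> u\<close> would have negative squared norm.\<close>

section \<open>Rank-one matrices and Bessel's inequality for a code\<close>

definition outer :: "real ^ 'n \<Rightarrow> real ^ 'n \<Rightarrow> real ^ 'n ^ 'n" where
  "outer a b = (\<chi> i j. a $ i * b $ j)"

lemma inner_outer: "outer a b \<bullet> outer c d = (a \<bullet> c) * (b \<bullet> d)"
  by (simp add: outer_def inner_vec_def sum_product mult_ac)

lemma gchoose_two: "(a::real) gchoose 2 = a * (a - 1) / 2"
  by (simp add: numeral_2_eq_2 gbinomial_Suc)

locale real_code =
  fixes \<alpha> :: real and C :: "(real ^ 'r) set"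
  assumes alpha_pos: "0 < \<alpha>" and alpha_le: "\<alpha> \<le> 1 / 7"
    and code: "spherical_code \<alpha> C"
begin

lemma finite_code: "finite C"
  using code by (simp add: spherical_code_def)

lemma inner_self: "u \<in> C \<Longrightarrow> u \<bullet> u = 1"
  using code by (simp add: spherical_code_def dot_square_norm)

lemma inner_distinct: "u \<in> C \<Longrightarrow> v \<in> C \<Longrightarrow> u \<noteq> v \<Longrightarrow> u \<bullet> v = \<alpha> \<or> u \<bullet> v = - \<alpha>"
  using code by (auto simp add: spherical_code_def)

lemma inner_le: "u \<in> C \<Longrightarrow> v \<in> C \<Longrightarrow> u \<noteq> v \<Longrightarrow> u \<bullet> v \<le> \<alpha>"
  using inner_distinct alpha_pos by fastforce

text \<open>Squaring removes the unknown signs: the entrywise square of the Gram matrix is 1 on the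
  diagonal and \<open>\<alpha>\<^sup>2\<close> off it.\<close>

lemma sum_inner_square:
  assumes "w \<in> C"
  shows "(\<Sum>u\<in>C. f u * (w \<bullet> u)\<^sup>2) = \<alpha>\<^sup>2 * (\<Sum>u\<in>C. f u) + (1 - \<alpha>\<^sup>2) * f w"
proof -
  have sq: "(w \<bullet> u)\<^sup>2 = \<alpha>\<^sup>2" if "u \<in> C - {w}" for u
    using inner_distinct[of w u] that assms by auto
  have "(\<Sum>u\<in>C. f u * (w \<bullet> u)\<^sup>2) = f w + (\<Sum>u\<in>C - {w}. f u * (w \<bullet> u)\<^sup>2)"
    using finite_code assms by (simp add: sum.remove inner_self)
  also have "(\<Sum>u\<in>C - {w}. f u * (w \<bullet> u)\<^sup>2) = \<alpha>\<^sup>2 * (\<Sum>u\<in>C - {w}. f u)"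
    unfolding sum_distrib_left by (rule sum.cong) (use sq in auto)
  also have "(\<Sum>u\<in>C - {w}. f u) = (\<Sum>u\<in>C. f u) - f w"
    using finite_code assms by (simp add: sum.remove)
  finally show ?thesis by (simp add: algebra_simps)
qed

text \<open>The eigenvalue of \<open>(1 - \<alpha>\<^sup>2) I + \<alpha>\<^sup>2 J\<close> at the
  all-ones vector, and also the squared norm of every row of the Gram matrix.\<close>

definition \<beta> :: real where "\<beta> = 1 - \<alpha>\<^sup>2 + \<alpha>\<^sup>2 * card C"

lemma alpha_square_le: "\<alpha>\<^sup>2 \<le> 1 / 49"
proof -
  have "\<alpha>\<^sup>2 \<le> (1/7)\<^sup>2" using alpha_pos alpha_le by (intro power_mono) auto
  then show ?thesis by (simp add: power2_eq_square)
qed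

lemma beta_pos: "\<beta> > 0"
proof -
  have "0 \<le> \<alpha>\<^sup>2 * real (card C)" by simp
  then show ?thesis unfolding \<beta>_def using alpha_square_le by linarith
qed

text \<open>Bessel's inequality for the matrices \<open>u u\<^sup>T\<close>, whose Gram matrix is
  \<open>(1 - \<alpha>\<^sup>2) I + \<alpha>\<^sup>2 J\<close>; \<open>Y\<close> is \<open>1 - \<alpha>\<^sup>2\<close> times the projection of \<open>X\<close> onto their span.\<close>

lemma projection_bound:
  fixes X :: "real ^ 'r ^ 'r"
  defines "q \<equiv> \<lambda>u. X \<bullet> outer u u"
  shows "(\<Sum>u\<in>C. (q u)\<^sup>2) - \<alpha>\<^sup>2 * (\<Sum>u\<in>C. q u)\<^sup>2 / \<beta> \<le> (1 - \<alpha>\<^sup>2) * (X \<bullet> X)"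
proof -
  define Q where "Q = (\<Sum>u\<in>C. q u)"
  define R where "R = (\<Sum>u\<in>C. (q u)\<^sup>2)"
  define n where "n = real (card C)"
  \<comment> \<open>The normal equations \<open>((1 - \<alpha>\<^sup>2) I + \<alpha>\<^sup>2 J) c =
    (1 - \<alpha>\<^sup>2) q\<close> are solved by subtracting one constant from all entries of
    \<open>q\<close>; the condition on it is \<open>kg\<close> below.\<close>
  define g where "g = \<alpha>\<^sup>2 * Q / \<beta>"
  define c where "c = (\<lambda>u. q u - g)"
  define Y where "Y = (\<Sum>u\<in>C. c u *\<^sub>R outer u u)"
  define k where "k = 1 - \<alpha>\<^sup>2"
  have k: "k > 0" using alpha_square_le by (simp add: k_def)
  have qu: "X \<bullet> outer u u = q u" for u by (simp add: q_def)
  have XY: "X \<bullet> Y = R - g * Q"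
    unfolding Y_def inner_sum_right inner_scaleR_right qu c_def R_def Q_def
    by (simp add: algebra_simps sum_subtractf sum_distrib_left power2_eq_square)
  have sc: "sum c C = Q - n * g"
    by (simp add: c_def sum_subtractf Q_def n_def)
  have scc: "(\<Sum>u\<in>C. c u * c u) = R - 2 * g * Q + n * g\<^sup>2"
    by (simp add: c_def algebra_simps sum_subtractf sum.distrib R_def Q_def n_def
        sum_distrib_left power2_eq_square) (simp add: sum_distrib_left[symmetric] sum_distrib_right[symmetric])
  have "Y \<bullet> Y = (\<Sum>w\<in>C. c w * (\<Sum>u\<in>C. c u * (w \<bullet> u)\<^sup>2))"
    unfolding Y_def inner_sum_right inner_sum_left
    by (simp add: inner_outer power2_eq_square sum_distrib_left mult_ac inner_commute)
  also have "\<dots> = (\<Sum>w\<in>C. c w * (\<alpha>\<^sup>2 * sum c C + k * c w))"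
    by (intro sum.cong) (auto simp: sum_inner_square k_def)
  also have "\<dots> = \<alpha>\<^sup>2 * (sum c C)\<^sup>2 + k * (\<Sum>u\<in>C. c u * c u)"
    by (simp add: algebra_simps sum.distrib sum_distrib_left power2_eq_square sum_distrib_right)
  finally have YY: "Y \<bullet> Y = \<alpha>\<^sup>2 * (Q - n * g)\<^sup>2 + k * (R - 2 * g * Q + n * g\<^sup>2)"
    by (simp add: sc scc)
  have gb: "g * \<beta> = \<alpha>\<^sup>2 * Q" using beta_pos by (simp add: g_def)
  have "\<beta> = k + \<alpha>\<^sup>2 * n" by (simp add: \<beta>_def k_def n_def)
  then have kg: "k * g = \<alpha>\<^sup>2 * (Q - n * g)" using gb by (simp add: algebra_simps)
  have "0 \<le> (k *\<^sub>R X - Y) \<bullet> (k *\<^sub>R X - Y)" by simp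
  also have "\<dots> = k * k * (X \<bullet> X) - 2 * k * (X \<bullet> Y) + Y \<bullet> Y"
    by (simp add: inner_diff_left inner_diff_right inner_commute algebra_simps)
  also have "\<dots> = k * (k * (X \<bullet> X) - R + n * g\<^sup>2) + (Q - n * g) * (\<alpha>\<^sup>2 * (Q - n * g))"
    unfolding XY YY by (simp add: algebra_simps power2_eq_square)
  also have "\<dots> = k * (k * (X \<bullet> X) - R + g * Q)"
    unfolding kg[symmetric] by (simp add: algebra_simps power2_eq_square)
  finally have "0 \<le> k * (X \<bullet> X) - R + g * Q"
    using k by (simp add: zero_le_mult_iff)
  moreover have "g * Q = \<alpha>\<^sup>2 * Q\<^sup>2 / \<beta>" by (simp add: g_def power2_eq_square)
  ultimately show ?thesis unfolding Q_def[symmetric] R_def[symmetric] k_def[symmetric] by linarith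
qed

section \<open>Neighbourhoods, stars and linear dependences\<close>

definition nbrs :: "real ^ 'r \<Rightarrow> (real ^ 'r) set" where
  "nbrs w = {v \<in> C. w \<bullet> v = - \<alpha>}"

lemma nbrs_subset: "nbrs w \<subseteq> C" and finite_nbrs: "finite (nbrs w)"
  using finite_code by (auto simp: nbrs_def)

lemma self_notin_nbrs: "w \<in> C \<Longrightarrow> w \<notin> nbrs w"
  using alpha_pos by (auto simp: nbrs_def inner_self)

lemma degree_eq:
  assumes "w \<in> C"
  shows "graph_degree (code_graph \<alpha> C) w = card (nbrs w)"
proof -
  have "{e \<in> snd (code_graph \<alpha> C). w \<in> e} = (\<lambda>v. {w, v}) ` nbrs w"
    using assms self_notin_nbrs[OF assms]
    by (auto simp: code_graph_def nbrs_def inner_commute)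
  moreover have "inj_on (\<lambda>v. {w, v}) (nbrs w)"
    by (auto simp: inj_on_def doubleton_eq_iff)
  ultimately show ?thesis by (simp add: graph_degree_def card_image)
qed

text \<open>The first two terms are the squared norm if all inner products of distinct vectors were
  \<alpha>. The edges from \<open>w\<close> to \<open>S\<close> change it by
  \<open>- 4 * \<alpha> * c * d\<close>, and edges inside \<open>S\<close> can only lower
  it.\<close>

lemma star_norm_le:
  fixes c :: real
  assumes w: "w \<in> C" and S: "S \<subseteq> nbrs w"
  defines "Z \<equiv> c *\<^sub>R w + \<Sum>S" and "d \<equiv> real (card S)"
  shows "Z \<bullet> Z \<le> \<alpha> * (c + d)\<^sup>2 + (1 - \<alpha>) * (c\<^sup>2 + d) - 4 * \<alpha> * c * d"
proof -
  have SC: "S \<subseteq> C" using S nbrs_subset by blast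
  then have fin: "finite S" using finite_code finite_subset by blast
  have wS: "w \<bullet> \<Sum>S = - \<alpha> * d"
  proof -
    have "(\<Sum>v\<in>S. w \<bullet> v) = (\<Sum>v\<in>S. - \<alpha>)" by (rule sum.cong) (use S in \<open>auto simp: nbrs_def\<close>)
    then show ?thesis by (simp add: inner_sum_right d_def)
  qed
  have "\<Sum>S \<bullet> \<Sum>S = (\<Sum>u\<in>S. \<Sum>v\<in>S. u \<bullet> v)"
    by (simp add: inner_sum_left inner_sum_right) (rule sum.swap)
  also have "\<dots> \<le> (\<Sum>u\<in>S. \<Sum>v\<in>S. \<alpha> + (if u = v then 1 - \<alpha> else 0))"
    using SC inner_le by (intro sum_mono) (auto simp: inner_self subset_iff)
  also have "\<dots> = \<alpha> * d\<^sup>2 + (1 - \<alpha>) * d"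
    using fin by (simp add: sum.distrib d_def power2_eq_square algebra_simps)
  finally have "\<Sum>S \<bullet> \<Sum>S \<le> \<alpha> * d\<^sup>2 + (1 - \<alpha>) * d" .
  moreover have "Z \<bullet> Z = c\<^sup>2 + 2 * c * (w \<bullet> \<Sum>S) + \<Sum>S \<bullet> \<Sum>S"
    using inner_self[OF w]
    by (simp add: Z_def inner_add_left inner_add_right inner_commute power2_eq_square algebra_simps)
  ultimately show ?thesis unfolding wS by (simp add: power2_eq_square algebra_simps)
qed

text \<open>The positive and negative parts of the dependence give the same vector \<open>Y\<close>
  and have disjoint supports, so \<open>Y \<bullet> Y\<close> expands into products of distinct code
  vectors and is at most \<open>\<alpha> * a\<^sup>2\<close>. Subtracting a multiple of
  \<open>Y\<close> from the weighted star \<open>Z\<close> then cancels the term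
  \<open>\<alpha> * (c + d)\<^sup>2\<close> of \<open>star_norm_le\<close>.\<close>

lemma star_and_dependence_aux:
  assumes w: "w \<in> C" and D: "D \<subseteq> C"
    and far: "\<And>u v. u \<in> insert w (nbrs w) \<Longrightarrow> v \<in> D \<Longrightarrow> u \<bullet> v = \<alpha>"
    and dep: "(\<Sum>v\<in>D. y v *\<^sub>R v) = 0" and nz: "v0 \<in> D" "y v0 \<noteq> 0"
    and le: "(\<Sum>v\<in>D. max (- y v) 0) \<le> (\<Sum>v\<in>D. max (y v) 0)"
  shows "sqrt (card (nbrs w)) \<le> (1 - \<alpha>) / (2 * \<alpha>)"
proof (cases "card (nbrs w) = 0")
  case True
  then show ?thesis using alpha_pos alpha_le by simp
next
  case False
  define d where "d = real (card (nbrs w))"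
  have d: "d > 0" using False by (simp add: d_def)
  \<comment> \<open>This weight minimises \<open>(c\<^sup>2 + d) / (c * d)\<close> and so makes the
    final condition \<open>4 * \<alpha> * c * d \<le> (1 - \<alpha>) * (c\<^sup>2 + d)\<close>
    strongest.\<close>
  define c where "c = sqrt d"
  have cc: "c * c = d" "c > 0" using d by (auto simp: c_def)
  have finD: "finite D" using D finite_code finite_subset by blast
  define p m where "p = (\<lambda>v. max (y v) 0)" and "m = (\<lambda>v. max (- y v) 0)"
  define a where "a = sum p D"
  define Y where "Y = (\<Sum>v\<in>D. p v *\<^sub>R v)"
  define Z where "Z = c *\<^sub>R w + \<Sum>(nbrs w)"
  have pm: "p v \<ge> 0" "m v \<ge> 0" "p v - m v = y v" "p v * m v = 0" for v
    by (auto simp: p_def m_def)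
  have a_ge: "sum m D \<le> a" using le by (simp add: a_def p_def m_def)
  have a: "a > 0"
  proof (rule ccontr)
    assume "\<not> a > 0"
    moreover have "a \<ge> 0" "sum m D \<ge> 0" unfolding a_def by (auto intro!: sum_nonneg pm)
    ultimately have "sum p D = 0" "sum m D = 0" using a_ge by (auto simp: a_def)
    then have "p v0 = 0" "m v0 = 0"
      using nz(1) finD pm by (auto simp: sum_nonneg_eq_0_iff)
    then show False using pm(3)[of v0] nz(2) by simp
  qed
  have "Y - (\<Sum>v\<in>D. m v *\<^sub>R v) = (\<Sum>v\<in>D. y v *\<^sub>R v)"
    unfolding Y_def by (simp add: sum_subtractf[symmetric] scaleR_left_diff_distrib[symmetric] pm)
  then have Ym: "Y = (\<Sum>v\<in>D. m v *\<^sub>R v)" using dep by simp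
  have "Y \<bullet> Y = (\<Sum>u\<in>D. p u *\<^sub>R u) \<bullet> (\<Sum>v\<in>D. m v *\<^sub>R v)"
    using Y_def Ym by metis
  also have "\<dots> = (\<Sum>u\<in>D. \<Sum>v\<in>D. p u * m v * (u \<bullet> v))"
    by (simp add: inner_sum_left inner_sum_right mult_ac sum_distrib_left)
       (rule sum.swap)
  also have "\<dots> \<le> (\<Sum>u\<in>D. \<Sum>v\<in>D. p u * m v * \<alpha>)"
  proof (intro sum_mono)
    fix u v assume uv: "u \<in> D" "v \<in> D"
    show "p u * m v * (u \<bullet> v) \<le> p u * m v * \<alpha>"
    proof (cases "u = v")
      case True
      then have "p u * m v = 0" using pm(4) by metis
      then show ?thesis by (simp only: mult_zero_left order_refl)
    next
      case False
      then show ?thesis using uv D pm inner_le[of u v] by (intro mult_left_mono) auto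
    qed
  qed
  also have "\<dots> = \<alpha> * a * sum m D"
    unfolding a_def by (simp add: sum_product sum_distrib_left mult_ac)
  also have "\<dots> \<le> \<alpha> * a * a" using a_ge a alpha_pos by (intro mult_left_mono) auto
  finally have YY: "Y \<bullet> Y \<le> \<alpha> * a\<^sup>2" by (simp add: power2_eq_square mult_ac)
  have inY: "u \<bullet> Y = \<alpha> * a" if "u \<in> insert w (nbrs w)" for u
  proof -
    have "u \<bullet> Y = (\<Sum>v\<in>D. p v * (u \<bullet> v))" by (simp add: Y_def inner_sum_right)
    also have "\<dots> = (\<Sum>v\<in>D. p v * \<alpha>)" by (rule sum.cong) (use far that in auto)
    finally show ?thesis by (simp add: a_def sum_distrib_left mult_ac)
  qed
  have ZY: "Z \<bullet> Y = \<alpha> * a * (c + d)"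
    by (simp add: Z_def inner_add_left inner_sum_left inY d_def algebra_simps)
  have ZZ: "Z \<bullet> Z \<le> \<alpha> * (c + d)\<^sup>2 + (1 - \<alpha>) * (c\<^sup>2 + d) - 4 * \<alpha> * c * d"
    unfolding Z_def d_def by (rule star_norm_le[OF w]) simp
  \<comment> \<open>This factor minimises the upper bound on the squared norm of
    \<open>Z - k *\<^sub>R Y\<close> that \<open>YY\<close> and \<open>ZY\<close> provide.\<close>
  define k where "k = (c + d) / a"
  have ka: "k * a = c + d" using a by (simp add: k_def)
  have "0 \<le> (Z - k *\<^sub>R Y) \<bullet> (Z - k *\<^sub>R Y)" by simp
  also have "\<dots> = Z \<bullet> Z - 2 * k * (Z \<bullet> Y) + k\<^sup>2 * (Y \<bullet> Y)"
    by (simp add: inner_diff_left inner_diff_right inner_commute power2_eq_square algebra_simps)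
  also have "\<dots> \<le> Z \<bullet> Z - 2 * k * (\<alpha> * a * (c + d)) + k\<^sup>2 * (\<alpha> * a\<^sup>2)"
    using YY by (simp add: ZY mult_left_mono)
  also have "\<dots> = Z \<bullet> Z - 2 * \<alpha> * (k * a) * (c + d) + \<alpha> * (k * a)\<^sup>2"
    by (simp add: power2_eq_square algebra_simps)
  also have "\<dots> = Z \<bullet> Z - \<alpha> * (c + d)\<^sup>2"
    unfolding ka by (simp add: power2_eq_square algebra_simps)
  also have "\<dots> \<le> (1 - \<alpha>) * (c\<^sup>2 + d) - 4 * \<alpha> * c * d" using ZZ by simp
  also have "\<dots> = 2 * d * (1 - \<alpha> - 2 * \<alpha> * c)"
    using cc by (simp add: power2_eq_square algebra_simps)
  finally have "2 * \<alpha> * c \<le> 1 - \<alpha>" using d by (simp add: zero_le_mult_iff)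
  then show ?thesis using alpha_pos by (simp add: c_def d_def field_simps)
qed

lemma star_and_dependence:
  assumes w: "w \<in> C" and D: "D \<subseteq> C"
    and far: "\<And>u v. u \<in> insert w (nbrs w) \<Longrightarrow> v \<in> D \<Longrightarrow> u \<bullet> v = \<alpha>"
    and dep: "dependent D"
  shows "sqrt (card (nbrs w)) \<le> (1 - \<alpha>) / (2 * \<alpha>)"
proof -
  have "finite D" using D finite_code finite_subset by blast
  then obtain y v0 where y: "v0 \<in> D" "y v0 \<noteq> 0" "(\<Sum>v\<in>D. y v *\<^sub>R v) = 0"
    using dep by (auto simp: dependent_finite)
  \<comment> \<open>Negating a dependence swaps its two parts, so the positive part may be taken as
    the heavier one.\<close>
  show ?thesis
  proof (cases "(\<Sum>v\<in>D. max (- y v) 0) \<le> (\<Sum>v\<in>D. max (y v) 0)")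
    case True
    then show ?thesis using star_and_dependence_aux[OF w D far y(3,1,2)] by blast
  next
    case False
    then show ?thesis
      using star_and_dependence_aux[OF w D far, of "\<lambda>v. - y v" v0] y
      by (simp add: sum_negf)
  qed
qed

lemma degree_le_of_card:
  assumes w: "w \<in> C" and deg: "\<And>u. u \<in> C \<Longrightarrow> card (nbrs u) \<le> k"
    and big: "card C > CARD('r) + (1 + k + k * k)"
  shows "sqrt (card (nbrs w)) \<le> (1 - \<alpha>) / (2 * \<alpha>)"
proof -
  \<comment> \<open>The ball of radius 2 around \<open>w\<close>: a code vector outside it is
    neither equal nor adjacent to \<open>w\<close> or to a neighbour of \<open>w\<close>.\<close>
  define B where "B = insert w (nbrs w \<union> (\<Union>u\<in>nbrs w. nbrs u))"
  have "card (\<Union>u\<in>nbrs w. nbrs u) \<le> (\<Sum>u\<in>nbrs w. card (nbrs u))"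
    by (rule card_UN_le) (rule finite_nbrs)
  also have "\<dots> \<le> card (nbrs w) * k"
    using sum_bounded_above[of "nbrs w" "\<lambda>u. card (nbrs u)" k] deg nbrs_subset by auto
  also have "\<dots> \<le> k * k" using deg[OF w] by simp
  finally have "card (nbrs w \<union> (\<Union>u\<in>nbrs w. nbrs u)) \<le> k + k * k"
    using deg[OF w] card_Un_le[of "nbrs w" "\<Union>u\<in>nbrs w. nbrs u"] by linarith
  then have cB: "card B \<le> 1 + k + k * k"
    unfolding B_def using card_insert_le_m1[of "1 + k + k * k" "nbrs w \<union> (\<Union>u\<in>nbrs w. nbrs u)" w]
    by simp
  have finB: "finite B" by (simp add: B_def finite_nbrs)
  have "card (C - B) > CARD('r)"
    using big cB diff_card_le_card_Diff[OF finB, of C] by linarith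
  then have "dependent (C - B)"
    using dependent_biggerset[of "C - B"] finite_code by simp
  moreover have "u \<bullet> v = \<alpha>" if "u \<in> insert w (nbrs w)" "v \<in> C - B" for u v
  proof -
    have "v \<notin> nbrs u" "u \<noteq> v" "u \<in> C" "v \<in> C"
      using that w nbrs_subset by (auto simp: B_def)
    then show ?thesis using inner_distinct[of u v] by (auto simp: nbrs_def)
  qed
  ultimately show ?thesis using star_and_dependence[OF w, of "C - B"] by blast
qed

end

section \<open>Lower bound on the entries of the eigenvector\<close>

locale nonneg_eigenvector = real_code \<alpha> C for \<alpha> :: real and C :: "(real ^ 'r) set" +
  fixes \<mu> :: real and x :: "real ^ 'r \<Rightarrow> real"
  assumes card_ge: "(1 / \<alpha>\<^sup>2 - 1) * (1 / \<alpha>\<^sup>2 - 2) / 2 \<le> real (card C)"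
    and mu_gt: "(1 - \<alpha>\<^sup>2) / (2 * \<alpha>\<^sup>2) < \<mu>"
    and eig: "u \<in> C \<Longrightarrow> (\<Sum>v\<in>C. (u \<bullet> v) * x v) = \<mu> * x u"
    and nonneg: "u \<in> C \<Longrightarrow> 0 \<le> x u"
    and unit: "(\<Sum>u\<in>C. (x u)\<^sup>2) = 1"
begin

definition m :: real where "m = (1 - \<alpha>\<^sup>2) / (2 * \<alpha>\<^sup>2)"
definition n :: real where "n = real (card C)"
text \<open>With \<open>U\<close> the matrix whose columns are the code vectors, this is
  \<open>U x\<close>, an eigenvector of \<open>U U\<^sup>T\<close> for \<open>\<mu>\<close>.\<close>

definition V :: "real ^ 'r" where "V = (\<Sum>u\<in>C. x u *\<^sub>R u)"

lemma m_pos: "m > 0"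
  using alpha_pos alpha_square_le by (simp add: m_def)

lemma mu_gt_m: "m < \<mu>"
  using mu_gt by (simp add: m_def)

lemma mu_pos: "\<mu> > 0"
  using m_pos mu_gt_m by simp

lemma alpha_m: "2 * \<alpha>\<^sup>2 * m = 1 - \<alpha>\<^sup>2"
  using alpha_pos by (simp add: m_def)

lemma beta_eq: "\<beta> = 1 - \<alpha>\<^sup>2 + \<alpha>\<^sup>2 * n"
  by (simp add: \<beta>_def n_def)

lemma inner_V: "u \<in> C \<Longrightarrow> u \<bullet> V = \<mu> * x u"
  by (simp add: V_def inner_sum_right mult.commute flip: eig)

lemma V_V: "V \<bullet> V = \<mu>"
proof -
  have "V \<bullet> V = (\<Sum>u\<in>C. x u * (u \<bullet> V))"
    by (subst V_def) (simp add: inner_sum_left)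
  also have "\<dots> = \<mu> * (\<Sum>u\<in>C. (x u)\<^sup>2)"
    unfolding sum_distrib_left by (intro sum.cong) (auto simp: inner_V power2_eq_square)
  finally show ?thesis by (simp add: unit)
qed

text \<open>\<open>projection_bound\<close> is applied to a matrix \<open>X\<close> for which the
  eigenvalue equation evaluates everything: the norm of \<open>X\<close>, the sum of its pairings
  with the \<open>outer u u\<close> and the sum of their squares depend only on \<alpha>,
  \<open>\<mu>\<close> and \<open>x w\<close>.\<close>

lemma entry_bound:
  assumes w: "w \<in> C"
  shows "\<beta> * (\<mu> - m) \<le> \<mu> * (x w)\<^sup>2 * (\<mu>\<^sup>2 - m * \<beta>)"
proof -
  define X where "X = outer V w + outer w V"
  have q: "X \<bullet> outer u u = 2 * \<mu> * (x u * (w \<bullet> u))" if "u \<in> C" for u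
  proof -
    have "X \<bullet> outer u u = 2 * ((V \<bullet> u) * (w \<bullet> u))"
      by (simp add: X_def inner_add_left inner_outer)
    then show ?thesis using inner_V[OF that] by (simp add: inner_commute[of V u])
  qed
  have "(\<Sum>u\<in>C. (X \<bullet> outer u u)\<^sup>2) = (\<Sum>u\<in>C. 4 * \<mu>\<^sup>2 * ((x u)\<^sup>2 * (w \<bullet> u)\<^sup>2))"
    by (intro sum.cong) (auto simp: q power2_eq_square)
  also have "\<dots> = 4 * \<mu>\<^sup>2 * (\<alpha>\<^sup>2 + (1 - \<alpha>\<^sup>2) * (x w)\<^sup>2)"
    unfolding sum_distrib_left[symmetric] by (subst sum_inner_square[OF w]) (simp add: unit)
  finally have sq: "(\<Sum>u\<in>C. (X \<bullet> outer u u)\<^sup>2) = 4 * \<mu>\<^sup>2 * (\<alpha>\<^sup>2 + (1 - \<alpha>\<^sup>2) * (x w)\<^sup>2)" .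
  have "(\<Sum>u\<in>C. X \<bullet> outer u u) = 2 * \<mu> * (\<Sum>u\<in>C. (w \<bullet> u) * x u)"
    unfolding sum_distrib_left by (intro sum.cong) (auto simp: q)
  then have Q: "(\<Sum>u\<in>C. X \<bullet> outer u u) = 2 * \<mu>\<^sup>2 * x w"
    by (simp add: eig[OF w] power2_eq_square)
  have XX: "X \<bullet> X = 2 * \<mu> + 2 * \<mu>\<^sup>2 * (x w)\<^sup>2"
    using inner_self[OF w] V_V inner_V[OF w]
    by (simp add: X_def inner_add_left inner_add_right inner_outer inner_commute[of V w] power2_eq_square)
  define t where "t = (x w)\<^sup>2"
  have "4 * \<mu>\<^sup>2 * (\<alpha>\<^sup>2 + (1 - \<alpha>\<^sup>2) * t) - \<alpha>\<^sup>2 * (4 * \<mu>^4 * t) / \<beta>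
      \<le> (1 - \<alpha>\<^sup>2) * (2 * \<mu> + 2 * \<mu>\<^sup>2 * t)"
    using projection_bound[of X] unfolding sq Q XX t_def[symmetric]
    by (simp add: power_mult_distrib t_def)
  then have "4 * \<mu>\<^sup>2 * (\<alpha>\<^sup>2 + 2 * \<alpha>\<^sup>2 * m * t) - \<alpha>\<^sup>2 * (4 * \<mu>^4 * t) / \<beta>
      \<le> 2 * \<alpha>\<^sup>2 * m * (2 * \<mu> + 2 * \<mu>\<^sup>2 * t)"
    unfolding alpha_m .
  then have "4 * \<mu> * \<alpha>\<^sup>2 * (\<mu> * (1 + 2 * m * t) - \<mu>^3 * t / \<beta>)
      \<le> 4 * \<mu> * \<alpha>\<^sup>2 * (m * (1 + \<mu> * t))"
    by (simp add: algebra_simps power2_eq_square power3_eq_cube power4_eq_xxxx)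
  then have "\<mu> * (1 + 2 * m * t) - \<mu>^3 * t / \<beta> \<le> m * (1 + \<mu> * t)"
    using mu_pos alpha_pos by (simp add: mult_le_cancel_left_pos)
  then have "\<beta> * (\<mu> * (1 + 2 * m * t)) - \<mu>^3 * t \<le> \<beta> * (m * (1 + \<mu> * t))"
    using beta_pos by (simp add: field_simps)
  then show ?thesis
    unfolding t_def[symmetric] by (simp add: algebra_simps power2_eq_square power3_eq_cube)
qed

text \<open>The right side is the squared Frobenius norm of the Gram matrix: each of its
  \<open>n\<close> rows has squared norm \<open>\<beta>\<close>.\<close>

lemma mu_square_le: "\<mu>\<^sup>2 \<le> n * \<beta>"
proof -
  have "(\<mu> * x u)\<^sup>2 \<le> \<beta>" if u: "u \<in> C" for u
  proof -
    have "(\<mu> * x u)\<^sup>2 = (\<Sum>v\<in>C. (u \<bullet> v) * x v)\<^sup>2" by (simp add: eig[OF u])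
    also have "\<dots> \<le> (\<Sum>v\<in>C. (u \<bullet> v)\<^sup>2) * (\<Sum>v\<in>C. (x v)\<^sup>2)"
      by (rule Cauchy_Schwarz_ineq_sum)
    also have "\<dots> = \<beta>"
      using sum_inner_square[OF u, of "\<lambda>_. 1"] by (simp add: unit \<beta>_def)
    finally show ?thesis .
  qed
  then have "(\<Sum>u\<in>C. (\<mu> * x u)\<^sup>2) \<le> n * \<beta>"
    using sum_bounded_above[of C "\<lambda>u. (\<mu> * x u)\<^sup>2" \<beta>] by (simp add: n_def)
  then show ?thesis
    by (simp add: power_mult_distrib unit flip: sum_distrib_left)
qed

lemma card_scaled_ge: "(1 - \<alpha>\<^sup>2) * (1 - 2 * \<alpha>\<^sup>2) / 2 \<le> \<alpha>^4 * n"
proof -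
  have "\<alpha>^4 * ((1 / \<alpha>\<^sup>2 - 1) * (1 / \<alpha>\<^sup>2 - 2) / 2) \<le> \<alpha>^4 * n"
    using card_ge alpha_pos unfolding n_def by (intro mult_left_mono) auto
  moreover have "\<alpha>^4 * ((1 / \<alpha>\<^sup>2 - 1) * (1 / \<alpha>\<^sup>2 - 2) / 2) = (1 - \<alpha>\<^sup>2) * (1 - 2 * \<alpha>\<^sup>2) / 2"
    using alpha_pos by (simp add: field_simps power2_eq_square power4_eq_xxxx)
  ultimately show ?thesis by simp
qed

text \<open>Equivalent to the binomial lower bound on the size of the code.\<close>

lemma m_le_beta: "m \<le> \<beta>"
proof -
  have "\<alpha>\<^sup>2 * (\<beta> - m) = \<alpha>\<^sup>2 * (1 - \<alpha>\<^sup>2 + \<alpha>\<^sup>2 * n) - (1 - \<alpha>\<^sup>2) / 2"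
    using alpha_m by (simp add: beta_eq algebra_simps)
  also have "\<dots> = \<alpha>^4 * n - (1 - \<alpha>\<^sup>2) * (1 - 2 * \<alpha>\<^sup>2) / 2"
    by (simp add: field_simps power2_eq_square power4_eq_xxxx)
  finally have "0 \<le> \<alpha>\<^sup>2 * (\<beta> - m)" using card_scaled_ge by simp
  then show ?thesis using alpha_pos by (simp add: zero_le_mult_iff)
qed

lemma m_alpha: "1 - \<alpha>\<^sup>2 \<le> m * \<alpha> * (1 - \<alpha>)"
proof -
  have "m * \<alpha> * (1 - \<alpha>) = (1 - \<alpha>\<^sup>2) * ((1 - \<alpha>) / (2 * \<alpha>))"
    using alpha_pos by (simp add: m_def field_simps power2_eq_square)
  moreover have "1 \<le> (1 - \<alpha>) / (2 * \<alpha>)" using alpha_pos alpha_le by simp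
  ultimately show ?thesis
    using alpha_square_le mult_left_mono[of 1 "(1 - \<alpha>) / (2 * \<alpha>)" "1 - \<alpha>\<^sup>2"] by simp
qed

lemma m_less_n: "m < n"
proof -
  have "\<alpha> * (1 - \<alpha>) \<le> 1/7 * 1"
    using alpha_pos alpha_le by (intro mult_mono) auto
  then have "m * (\<alpha> * (1 - \<alpha>)) \<le> m * (1/7 * 1)"
    using m_pos by (intro mult_left_mono) auto
  then have "1 - \<alpha>\<^sup>2 \<le> m / 7" using m_alpha by (simp only: mult.assoc)
  then have "m * (6/7) \<le> \<alpha>\<^sup>2 * n" using m_le_beta beta_eq by linarith
  moreover have "\<alpha>\<^sup>2 * n \<le> 1/49 * n" using alpha_square_le by (intro mult_right_mono) (auto simp: n_def)
  ultimately show ?thesis using m_pos by linarith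
qed

text \<open>The bound of \<open>entry_bound\<close> decreases in \<open>\<mu>\<close> because \<open>m \<le> \<beta>\<close>, so \<open>\<mu>\<close> may be replaced
  by its upper bound \<open>sqrt (n * \<beta>)\<close>.\<close>

lemma entry_ge:
  assumes w: "w \<in> C"
  shows "\<alpha> * (1 - \<alpha>) \<le> \<mu> * (x w)\<^sup>2"
proof -
  define s where "s = sqrt (n * \<beta>)"
  define e where "e = \<mu> * (x w)\<^sup>2"
  define \<delta> where "\<delta> = \<mu>\<^sup>2 - m * \<beta>"
  have n: "n > 0" using m_pos m_less_n by linarith
  have ss: "s * s = n * \<beta>" using n beta_pos by (simp add: s_def)
  have s_mu: "\<mu> \<le> s" unfolding s_def using mu_square_le by (rule real_le_rsqrt)
  have "(\<alpha> * n)\<^sup>2 \<le> n * \<beta>"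
    using n alpha_square_le by (simp add: beta_eq power2_eq_square algebra_simps)
  then have s_n: "\<alpha> * n \<le> s" unfolding s_def by (rule real_le_rsqrt)
  have e: "\<beta> * (\<mu> - m) \<le> e * \<delta>" using entry_bound[OF w] by (simp add: e_def \<delta>_def)
  have e0: "0 \<le> e" using mu_pos by (simp add: e_def)
  have "0 < \<beta> * (\<mu> - m)" using beta_pos mu_gt_m by simp
  then have "0 < e * \<delta>" using e by linarith
  then have d: "\<delta> > 0" using e0 by (simp add: zero_less_mult_iff)
  \<comment> \<open>Cross-multiplied form of \<open>f s \<le> f \<mu>\<close> for
    \<open>f t = (t - m) / (t\<^sup>2 - m * \<beta>)\<close>. At \<open>s\<close> the denominator is
    \<open>\<beta> * (n - m)\<close>, which with \<open>s_n\<close> leads to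
    \<open>e \<ge> (\<alpha> * n - m) / (n - m)\<close>.\<close>
  have "0 \<le> (s - \<mu>) * ((\<mu> - m) * (s - m) + m * (\<beta> - m))"
    using s_mu mu_gt_m m_pos m_le_beta by (intro mult_nonneg_nonneg add_nonneg_nonneg) auto
  also have "\<dots> = (\<mu> - m) * (s * s - m * \<beta>) - (s - m) * \<delta>"
    by (simp add: \<delta>_def algebra_simps power2_eq_square)
  also have "\<dots> = (\<beta> * (\<mu> - m)) * (n - m) - (s - m) * \<delta>"
    unfolding ss by (simp add: algebra_simps)
  also have "\<dots> \<le> (e * \<delta>) * (n - m) - (\<alpha> * n - m) * \<delta>"
    using e s_n d m_less_n by (intro diff_mono mult_right_mono) auto
  also have "\<dots> = \<delta> * (e * (n - m) - (\<alpha> * n - m))" by (simp add: algebra_simps)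
  finally have 1: "\<alpha> * n - m \<le> e * (n - m)" using d by (simp add: zero_le_mult_iff)
  \<comment> \<open>By \<open>m_alpha\<close> this falls short of \<open>\<alpha> * n - m\<close> by
    at least \<open>\<beta> - m\<close>.\<close>
  have "\<alpha> * (1 - \<alpha>) * (n - m) = \<alpha> * n - \<alpha>\<^sup>2 * n - m * \<alpha> * (1 - \<alpha>)"
    by (simp add: algebra_simps power2_eq_square)
  then have "\<alpha> * (1 - \<alpha>) * (n - m) \<le> \<alpha> * n - m"
    using m_alpha m_le_beta beta_eq by linarith
  then have "\<alpha> * (1 - \<alpha>) * (n - m) \<le> e * (n - m)" using 1 by linarith
  then show ?thesis using m_less_n by (simp add: e_def)
qed

section \<open>First bound on the degrees\<close>

text \<open>Cauchy-Schwarz for \<open>V\<close> and the star \<open>Z\<close>, where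
  \<open>Z \<bullet> V\<close> is at least \<open>\<mu> * b * y * (y + 1)\<close>. The weight
  \<open>y\<close> on \<open>w\<close> gives both sides a common factor
  \<open>y * y\<close>.\<close>

lemma star_inequality:
  assumes w: "w \<in> C" and S: "S \<subseteq> nbrs w" "S \<noteq> {}"
    and b: "0 \<le> b" "\<And>u. u \<in> C \<Longrightarrow> b \<le> x u"
  defines "y \<equiv> sqrt (card S)"
  shows "4 * \<alpha> * y \<le> 2 * (1 - \<alpha>) + (\<alpha> - \<mu> * b\<^sup>2) * (y + 1)\<^sup>2"
proof -
  have SC: "S \<subseteq> C" using S nbrs_subset by blast
  then have "finite S" using finite_code finite_subset by blast
  then have y: "y > 0" using S(2) by (simp add: y_def card_gt_0_iff)
  have d: "real (card S) = y * y" by (simp add: y_def)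
  define Z where "Z = y *\<^sub>R w + \<Sum>S"
  have "Z \<bullet> V = \<mu> * (y * x w + (\<Sum>u\<in>S. x u))"
    using inner_V SC w
    by (simp add: Z_def inner_add_left inner_sum_left algebra_simps sum_distrib_left subset_iff)
  moreover have "y * b + y * y * b \<le> y * x w + (\<Sum>u\<in>S. x u)"
    using y b(2) w SC sum_bounded_below[of S b x] d
    by (intro add_mono mult_left_mono) (auto simp: subset_iff)
  ultimately have "\<mu> * (y * b + y * y * b) \<le> Z \<bullet> V" using mu_pos by simp
  then have "(\<mu> * (y * b + y * y * b))\<^sup>2 \<le> (Z \<bullet> V)\<^sup>2"
    using mu_pos y b(1) by (intro power_mono) auto
  also have "\<dots> \<le> (Z \<bullet> Z) * (V \<bullet> V)" by (rule Cauchy_Schwarz_ineq)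
  finally have "\<mu> * (\<mu> * (y * b + y * y * b)\<^sup>2) \<le> \<mu> * (Z \<bullet> Z)"
    by (simp add: V_V power2_eq_square mult_ac)
  then have "\<mu> * (y * b + y * y * b)\<^sup>2 \<le> Z \<bullet> Z" using mu_pos by simp
  also have "\<dots> \<le> \<alpha> * (y + y * y)\<^sup>2 + (1 - \<alpha>) * (y\<^sup>2 + y * y) - 4 * \<alpha> * y * (y * y)"
    using star_norm_le[OF w S(1), of y] unfolding Z_def d .
  finally have "(y * y) * (4 * \<alpha> * y)
      \<le> (y * y) * (2 * (1 - \<alpha>) + (\<alpha> - \<mu> * b\<^sup>2) * (y + 1)\<^sup>2)"
    by (simp add: algebra_simps power2_eq_square)
  then show ?thesis using y by (simp add: mult_le_cancel_left_pos)
qed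

lemma code_nonempty: "C \<noteq> {}"
  using m_pos m_less_n by (auto simp: n_def)

lemma minimal_entry:
  obtains u0 where "u0 \<in> C" "\<And>u. u \<in> C \<Longrightarrow> x u0 \<le> x u"
  using ex_is_arg_min_if_finite[OF finite_code code_nonempty, of x]
  by (auto simp: is_arg_min_linorder)

lemma degree_less:
  assumes w: "w \<in> C"
  shows "real (card (nbrs w)) < 3 / (8 * \<alpha>\<^sup>2)"
proof (rule ccontr)
  assume "\<not> ?thesis"
  then have ge: "3 / (8 * \<alpha>\<^sup>2) \<le> real (card (nbrs w))" by simp
  \<comment> \<open>A subset of minimal size is used because
    \<open>4 * Y \<le> 2 + Y\<^sup>2\<close> fails only for \<open>Y\<close> between
    \<open>2 - sqrt 2\<close> and \<open>2 + sqrt 2\<close>, and a larger star could leave this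
    window. Rounding up costs at most \<open>\<alpha>\<^sup>2\<close> in
    \<open>Y\<^sup>2\<close>.\<close>
  define d where "d = nat \<lceil>3 / (8 * \<alpha>\<^sup>2)\<rceil>"
  have "0 < 3 / (8 * \<alpha>\<^sup>2)" using alpha_pos by simp
  then have d: "3 / (8 * \<alpha>\<^sup>2) \<le> real d" "real d \<le> 3 / (8 * \<alpha>\<^sup>2) + 1" "0 < d"
    unfolding d_def by linarith+
  have "d \<le> card (nbrs w)" using ge unfolding d_def by linarith
  then obtain S where S: "S \<subseteq> nbrs w" "card S = d" "finite S"
    by (rule obtain_subset_with_card_n)
  obtain u0 where u0: "u0 \<in> C" "\<And>u. u \<in> C \<Longrightarrow> x u0 \<le> x u" by (rule minimal_entry) blast
  define y where "y = sqrt d"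
  define Y where "Y = \<alpha> * y"
  have "S \<noteq> {}" using S d by auto
  then have "4 * \<alpha> * y \<le> 2 * (1 - \<alpha>) + (\<alpha> - \<mu> * (x u0)\<^sup>2) * (y + 1)\<^sup>2"
    using star_inequality[OF w S(1) _ nonneg[OF u0(1)] u0(2)] by (simp add: y_def S)
  also have "\<dots> \<le> 2 * (1 - \<alpha>) + \<alpha>\<^sup>2 * (y + 1)\<^sup>2"
  proof -
    have "\<alpha> - \<mu> * (x u0)\<^sup>2 \<le> \<alpha>\<^sup>2"
      using entry_ge[OF u0(1)] by (simp add: algebra_simps power2_eq_square)
    then show ?thesis by (intro add_left_mono mult_right_mono) auto
  qed
  also have "\<alpha>\<^sup>2 * (y + 1)\<^sup>2 = (Y + \<alpha>)\<^sup>2"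
    by (simp add: Y_def algebra_simps power2_eq_square)
  finally have main: "4 * Y \<le> 2 * (1 - \<alpha>) + (Y + \<alpha>)\<^sup>2" by (simp add: Y_def)
  have YY: "Y\<^sup>2 = \<alpha>\<^sup>2 * d" by (simp add: Y_def y_def power_mult_distrib)
  have "\<alpha>\<^sup>2 * (3 / (8 * \<alpha>\<^sup>2)) \<le> Y\<^sup>2" "Y\<^sup>2 \<le> \<alpha>\<^sup>2 * (3 / (8 * \<alpha>\<^sup>2) + 1)"
    unfolding YY using d(1,2) by (intro mult_left_mono; simp)+
  then have "3/8 \<le> Y\<^sup>2" "Y\<^sup>2 \<le> 3/8 + \<alpha>\<^sup>2"
    using alpha_pos by (simp_all add: distrib_left)
  then have Y2: "3/8 \<le> Y\<^sup>2" "Y\<^sup>2 \<le> 2/5" using alpha_square_le by auto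
  have Y0: "Y \<ge> 0" using alpha_pos by (simp add: Y_def y_def)
  \<comment> \<open>\<open>61/100\<close> is just below \<open>sqrt (3/8)\<close>, and 4 * 0.61 =
    2.44 exceeds the upper bound 2.4 on \<open>2 + Y\<^sup>2\<close>.\<close>
  have Yl: "Y \<ge> 61/100"
    using Y2(1) Y0 power2_le_imp_le[of "61/100" Y] by (simp add: power2_eq_square)
  have "Y \<le> 7/10"
    using Y2(2) power2_le_imp_le[of Y "7/10"] by (simp add: power2_eq_square)
  then have "\<alpha> * (2 * Y + \<alpha> - 2) \<le> 0"
    using alpha_pos alpha_le by (intro mult_nonneg_nonpos) auto
  then have "4 * Y \<le> 2 + Y\<^sup>2" using main by (simp add: algebra_simps power2_eq_square)
  then show False using Yl Y2(2) by linarith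
qed

section \<open>Refined entry and degree bounds\<close>

text \<open>The Gram matrix is \<open>\<alpha> J + (1 - \<alpha>) I - 2 \<alpha> A\<close> with
  \<open>A\<close> the adjacency matrix of the graph.\<close>

lemma row_sum:
  assumes u: "u \<in> C"
  shows "\<mu> * x u = \<alpha> * sum x C + (1 - \<alpha>) * x u - 2 * \<alpha> * sum x (nbrs u)"
proof -
  have "\<mu> * x u = (\<Sum>v\<in>C. (u \<bullet> v) * x v)" by (simp add: eig[OF u])
  also have "\<dots> = (\<Sum>v\<in>C. \<alpha> * x v + (if v = u then (1 - \<alpha>) * x v else 0)
      - (if v \<in> nbrs u then 2 * \<alpha> * x v else 0))"
  proof (rule sum.cong)
    fix v assume v: "v \<in> C"
    consider "v = u" | "v \<noteq> u" "u \<bullet> v = - \<alpha>" | "v \<noteq> u" "u \<bullet> v = \<alpha>"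
      using inner_distinct[OF u v] by blast
    then show "(u \<bullet> v) * x v = \<alpha> * x v + (if v = u then (1 - \<alpha>) * x v else 0)
      - (if v \<in> nbrs u then 2 * \<alpha> * x v else 0)"
      using alpha_pos self_notin_nbrs[OF u] inner_self[OF u] v
      by cases (auto simp: nbrs_def algebra_simps)
  qed simp
  also have "\<dots> = \<alpha> * sum x C + (1 - \<alpha>) * x u - 2 * \<alpha> * sum x (nbrs u)"
    using finite_code u nbrs_subset[of u]
    by (simp add: sum.distrib sum_subtractf sum.inter_restrict[symmetric] Int_absorb1
        flip: sum_distrib_left)
  finally show ?thesis .
qed

text \<open>The adjacency part of the quadratic form of the Gram matrix at \<open>x\<close> is
  nonpositive, since \<open>x\<close> has no negative entries.\<close>

lemma mu_le_sum: "\<mu> \<le> \<alpha> * (sum x C)\<^sup>2 + (1 - \<alpha>)"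
proof -
  have "\<mu> * (x u)\<^sup>2 \<le> \<alpha> * sum x C * x u + (1 - \<alpha>) * (x u)\<^sup>2" if u: "u \<in> C" for u
  proof -
    have "0 \<le> \<alpha> * sum x (nbrs u)"
      using alpha_pos nonneg nbrs_subset by (intro mult_nonneg_nonneg sum_nonneg) auto
    then have "\<mu> * x u \<le> \<alpha> * sum x C + (1 - \<alpha>) * x u" using row_sum[OF u] by linarith
    then have "(\<mu> * x u) * x u \<le> (\<alpha> * sum x C + (1 - \<alpha>) * x u) * x u"
      using nonneg[OF u] by (rule mult_right_mono)
    then show ?thesis by (simp add: algebra_simps power2_eq_square)
  qed
  then have "(\<Sum>u\<in>C. \<mu> * (x u)\<^sup>2) \<le> (\<Sum>u\<in>C. \<alpha> * sum x C * x u + (1 - \<alpha>) * (x u)\<^sup>2)"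
    by (rule sum_mono)
  moreover have "(\<Sum>u\<in>C. \<mu> * (x u)\<^sup>2) = \<mu>"
    by (simp add: unit flip: sum_distrib_left)
  moreover have "(\<Sum>u\<in>C. \<alpha> * sum x C * x u + (1 - \<alpha>) * (x u)\<^sup>2) = \<alpha> * (sum x C)\<^sup>2 + (1 - \<alpha>)"
    unfolding sum.distrib sum_distrib_left[symmetric] unit by (simp add: power2_eq_square)
  ultimately show ?thesis by simp
qed

lemma sum_square_le: "(sum x C)\<^sup>2 \<le> n"
  using Cauchy_Schwarz_ineq_sum[of "\<lambda>_. 1" x C] by (simp add: unit n_def)

lemma mu_ge: "n * (\<alpha> * (1 - \<alpha>)) \<le> \<mu>"
proof -
  have "n * (\<alpha> * (1 - \<alpha>)) \<le> (\<Sum>u\<in>C. \<mu> * (x u)\<^sup>2)"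
    using sum_bounded_below[of C "\<alpha> * (1 - \<alpha>)" "\<lambda>u. \<mu> * (x u)\<^sup>2"] entry_ge by (simp add: n_def)
  then show ?thesis by (simp add: unit flip: sum_distrib_left)
qed

text \<open>A vertex of small degree has an entry close to the average, which improves on \<open>entry_ge\<close>.\<close>

lemma entry_ge_refined:
  assumes u: "u \<in> C"
  shows "\<alpha> - \<mu> * (x u)\<^sup>2 \<le> 47/10 * \<alpha>^3"
proof -
  define P where "P = sum x C"
  define s where "s = sum x (nbrs u)"
  define k where "k = \<mu> - (1 - \<alpha>)"
  have n: "n > 0" using m_pos m_less_n by linarith
  have P0: "P \<ge> 0" unfolding P_def by (intro sum_nonneg nonneg)
  have s0: "s \<ge> 0" unfolding s_def using nonneg nbrs_subset by (intro sum_nonneg) auto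
  have a4: "23/49 \<le> \<alpha>^4 * n"
  proof -
    have "0 \<le> \<alpha>^4" by simp
    then have "1 - 3/49 \<le> 1 - 3 * \<alpha>\<^sup>2 + 2 * \<alpha>^4" using alpha_square_le by linarith
    also have "\<dots> = (1 - \<alpha>\<^sup>2) * (1 - 2 * \<alpha>\<^sup>2)"
      by (simp add: algebra_simps power2_eq_square power4_eq_xxxx)
    finally show ?thesis using card_scaled_ge by linarith
  qed
  have a3: "\<alpha>^3 \<le> 1/343"
    using power_mono[OF alpha_le, of 3] alpha_pos by (simp add: power3_eq_cube)
  have a3p: "\<alpha>^3 > 0" using alpha_pos by simp
  \<comment> \<open>Chosen so that \<open>mu_ge\<close> reads
    \<open>(1 - \<alpha>) * N \<le> k\<close>. The constant below comes from 23/49 - 1/343 = 160/343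
    > 0.466.\<close>
  define N where "N = n * \<alpha> - 1"
  have N: "466/1000 \<le> \<alpha>^3 * N"
  proof -
    have "\<alpha>^3 * N = \<alpha>^4 * n - \<alpha>^3" by (simp add: N_def algebra_simps power3_eq_cube power4_eq_xxxx)
    then show ?thesis using a4 a3 by linarith
  qed
  then have "0 < \<alpha>^3 * N" by linarith
  then have N0: "N > 0" using a3p by (rule zero_less_mult_pos)
  have kN: "(1 - \<alpha>) * N \<le> k"
    using mu_ge by (simp add: k_def N_def algebra_simps)
  have "(1 - \<alpha>) * N > 0" using N0 alpha_le by simp
  then have k0: "k > 0" using kN by linarith
  \<comment> \<open>Dropping the neighbour term of \<open>row_sum\<close> bounds every entry from
    above; with \<open>degree_less\<close> this makes the neighbour sum \<open>s\<close>
    small.\<close>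
  have xk: "x v * k \<le> \<alpha> * P" if v: "v \<in> C" for v
  proof -
    have "0 \<le> \<alpha> * sum x (nbrs v)"
      using alpha_pos nonneg nbrs_subset by (intro mult_nonneg_nonneg sum_nonneg) auto
    then show ?thesis using row_sum[OF v] by (simp add: k_def P_def algebra_simps)
  qed
  have "s * k = (\<Sum>v\<in>nbrs u. x v * k)" by (simp add: s_def sum_distrib_right)
  also have "\<dots> \<le> real (card (nbrs u)) * (\<alpha> * P)"
    using nbrs_subset xk by (intro sum_bounded_above) auto
  also have "\<dots> \<le> 3 / (8 * \<alpha>\<^sup>2) * (\<alpha> * P)"
    using degree_less[OF u] P0 alpha_pos by (intro mult_right_mono) auto
  finally have "\<alpha> * (s * k) \<le> \<alpha> * (3 / (8 * \<alpha>\<^sup>2) * (\<alpha> * P))"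
    using alpha_pos by (intro mult_left_mono) auto
  also have "\<dots> = 3/8 * P" using alpha_pos by (simp add: field_simps power2_eq_square)
  finally have "P * (\<alpha> * (s * k)) \<le> P * (3/8 * P)" using P0 by (rule mult_left_mono)
  also have "\<dots> \<le> 3/8 * n" using sum_square_le by (simp add: P_def power2_eq_square)
  finally have Tk: "(\<alpha> * P * s) * k \<le> 3/8 * n" by (simp add: mult_ac)
  define T where "T = \<alpha> * P * s"
  have T0: "T \<ge> 0" using P0 s0 alpha_pos by (simp add: T_def)
  have "T * ((1 - \<alpha>) * N) \<le> 3/8 * n"
    using mult_left_mono[OF kN T0] Tk unfolding T_def by linarith
  then have TN: "T * (1 - \<alpha>) * N \<le> 3/8 * n" by (simp add: mult_ac)
  \<comment> \<open>Squaring \<open>\<mu> * x u \<ge> \<alpha> * (P - 2 * s)\<close> gives this when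
    \<open>2 * s \<le> P\<close>; otherwise the left side is nonpositive.\<close>
  have low: "\<alpha>\<^sup>2 * (P\<^sup>2 - 4 * P * s) \<le> (\<mu> * x u)\<^sup>2"
  proof (cases "2 * s \<le> P")
    case True
    have "\<alpha> * P - 2 * \<alpha> * s \<le> \<mu> * x u"
      using row_sum[OF u] nonneg[OF u] alpha_le by (simp add: P_def s_def)
    then have "(\<alpha> * (P - 2 * s))\<^sup>2 \<le> (\<mu> * x u)\<^sup>2"
      using True alpha_pos by (intro power_mono) (auto simp: algebra_simps)
    moreover have "(\<alpha> * (P - 2 * s))\<^sup>2 = \<alpha>\<^sup>2 * (P\<^sup>2 - 4 * P * s) + (2 * \<alpha> * s)\<^sup>2"
      by (simp add: algebra_simps power2_eq_square)
    moreover have "0 \<le> (2 * \<alpha> * s)\<^sup>2" by simp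
    ultimately show ?thesis by linarith
  next
    case False
    have "P * (P - 4 * s) \<le> 0" using P0 False s0 by (intro mult_nonneg_nonpos) auto
    then have "\<alpha>\<^sup>2 * (P\<^sup>2 - 4 * P * s) \<le> 0"
      by (intro mult_nonneg_nonpos) (auto simp: algebra_simps power2_eq_square)
    then show ?thesis using zero_le_power2[of "\<mu> * x u"] by linarith
  qed
  define E where "E = \<alpha> - \<mu> * (x u)\<^sup>2"
  \<comment> \<open>By \<open>mu_le_sum\<close> the leading terms \<open>\<alpha> * \<mu>\<close>
    cancel, leaving \<open>1 - \<alpha>\<close> and the loss \<open>T\<close> due to the
    neighbours.\<close>
  have "\<mu> * E = \<alpha> * \<mu> - (\<mu> * x u)\<^sup>2" by (simp add: E_def algebra_simps power2_eq_square)
  also have "\<dots> \<le> \<alpha> * \<mu> - \<alpha> * (\<alpha> * P\<^sup>2) + 4 * \<alpha> * T"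
    using low by (simp add: T_def algebra_simps power2_eq_square)
  also have "\<dots> \<le> \<alpha> * \<mu> - \<alpha> * (\<mu> - (1 - \<alpha>)) + 4 * \<alpha> * T"
    using mu_le_sum alpha_pos by (simp add: P_def)
  also have "\<dots> = \<alpha> * (1 - \<alpha> + 4 * T)" by (simp add: algebra_simps)
  finally have muE: "\<mu> * E \<le> \<alpha> * (1 - \<alpha> + 4 * T)" .
  show ?thesis
  proof (cases "E \<le> 0")
    case True
    moreover have "0 \<le> 47/10 * \<alpha>^3" using a3p by simp
    ultimately show ?thesis unfolding E_def by linarith
  next
    case False
    then have "n * (\<alpha> * (1 - \<alpha>)) * E \<le> \<mu> * E" using mu_ge by (intro mult_right_mono) auto
    then have "\<alpha> * (n * (1 - \<alpha>) * E) \<le> \<alpha> * (1 - \<alpha> + 4 * T)" using muE by (simp add: mult_ac)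
    then have nE: "n * (1 - \<alpha>) * E \<le> 1 - \<alpha> + 4 * T" using alpha_pos by simp
    \<comment> \<open>The factor \<open>(1 - \<alpha>) * N\<close> makes \<open>TN\<close>
      applicable, after which \<open>n\<close> cancels.\<close>
    have "n * ((1 - \<alpha>)\<^sup>2 * N * E) = (1 - \<alpha>) * N * (n * (1 - \<alpha>) * E)"
      by (simp add: power2_eq_square mult_ac)
    also have "\<dots> \<le> (1 - \<alpha>) * N * (1 - \<alpha> + 4 * T)"
      using nE N0 alpha_le by (intro mult_left_mono) auto
    also have "\<dots> = (1 - \<alpha>)\<^sup>2 * N + 4 * (T * (1 - \<alpha>) * N)"
      by (simp add: power2_eq_square algebra_simps)
    also have "\<dots> \<le> (1 - \<alpha>)\<^sup>2 * (n * \<alpha>) + 3/2 * n"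
    proof -
      have "(1 - \<alpha>)\<^sup>2 * N \<le> (1 - \<alpha>)\<^sup>2 * (n * \<alpha>)"
        by (intro mult_left_mono) (auto simp: N_def)
      then show ?thesis using TN by simp
    qed
    also have "\<dots> = n * ((1 - \<alpha>)\<^sup>2 * \<alpha> + 3/2)" by (simp add: algebra_simps)
    finally have NE: "(1 - \<alpha>)\<^sup>2 * N * E \<le> (1 - \<alpha>)\<^sup>2 * \<alpha> + 3/2"
      using n by simp
    define r where "r = (1 - \<alpha>)\<^sup>2"
    have r: "36/49 \<le> r"
      using power_mono[of "6/7" "1 - \<alpha>" 2] alpha_le by (simp add: r_def power2_eq_square)
    have "r * (466/1000 * E) \<le> r * (\<alpha>^3 * N * E)"
      using N False r by (intro mult_left_mono mult_right_mono) auto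
    also have "\<dots> = \<alpha>^3 * (r * N * E)" by (simp add: mult_ac)
    also have "\<dots> \<le> \<alpha>^3 * (r * \<alpha> + 3/2)"
      using NE a3p by (simp add: r_def)
    \<comment> \<open>Here \<open>r * (49/24) \<ge> 3/2\<close> as \<open>r \<ge> 36/49\<close>.
      Dividing by \<open>r\<close> and by 0.466 leaves a constant below 4.69, rounded to
      \<open>47/10\<close>.\<close>
    also have "\<dots> \<le> \<alpha>^3 * (r * (1/7) + r * (49/24))"
      using a3p r alpha_le by (intro mult_left_mono add_mono) auto
    finally have "r * (466/1000 * E) \<le> r * (\<alpha>^3 * (1/7 + 49/24))" by (simp add: algebra_simps)
    then have "466/1000 * E \<le> \<alpha>^3 * (1/7 + 49/24)" using r by (simp add: mult_le_cancel_left)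
    then have "9786 * E \<le> 45875 * \<alpha>^3" by simp
    then have "E \<le> 47/10 * \<alpha>^3" using a3p by linarith
    then show ?thesis by (simp only: E_def)
  qed
qed

text \<open>With \<open>entry_ge_refined\<close> the error in \<open>star_inequality\<close> is
  \<alpha> times a bounded quantity, so the threshold for \<open>Y\<close> drops to
  \<open>1/2\<close>, the zero of \<open>4 * Y - 2\<close>. The whole neighbourhood can serve as the
  star because \<open>degree_less\<close> bounds \<open>Y\<close> from above.\<close>

lemma degree_less_refined:
  assumes w: "w \<in> C"
  shows "real (card (nbrs w)) < 1 / (4 * \<alpha>\<^sup>2)"
proof (rule ccontr)
  assume "\<not> ?thesis"
  then have ge: "1 / (4 * \<alpha>\<^sup>2) \<le> real (card (nbrs w))" by simp
  define d where "d = real (card (nbrs w))"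
  have "0 < 1 / (4 * \<alpha>\<^sup>2)" using alpha_pos by simp
  then have ne: "nbrs w \<noteq> {}" using ge by auto
  obtain u0 where u0: "u0 \<in> C" "\<And>u. u \<in> C \<Longrightarrow> x u0 \<le> x u" by (rule minimal_entry) blast
  define y where "y = sqrt d"
  define Y where "Y = \<alpha> * y"
  have "4 * \<alpha> * y \<le> 2 * (1 - \<alpha>) + (\<alpha> - \<mu> * (x u0)\<^sup>2) * (y + 1)\<^sup>2"
    using star_inequality[OF w order_refl ne nonneg[OF u0(1)] u0(2)] by (simp add: y_def d_def)
  also have "\<dots> \<le> 2 * (1 - \<alpha>) + 47/10 * \<alpha>^3 * (y + 1)\<^sup>2"
    using entry_ge_refined[OF u0(1)] by (intro add_left_mono mult_right_mono) auto
  also have "47/10 * \<alpha>^3 * (y + 1)\<^sup>2 = 47/10 * \<alpha> * (Y + \<alpha>)\<^sup>2"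
    by (simp add: Y_def algebra_simps power2_eq_square power3_eq_cube)
  finally have main: "4 * Y - 2 \<le> \<alpha> * (47/10 * (Y + \<alpha>)\<^sup>2 - 2)"
    by (simp add: Y_def algebra_simps)
  have YY: "Y\<^sup>2 = \<alpha>\<^sup>2 * d" by (simp add: Y_def y_def d_def power_mult_distrib)
  have "\<alpha>\<^sup>2 * (1 / (4 * \<alpha>\<^sup>2)) \<le> Y\<^sup>2" "Y\<^sup>2 \<le> \<alpha>\<^sup>2 * (3 / (8 * \<alpha>\<^sup>2))"
    unfolding YY d_def using ge degree_less[OF w] by (intro mult_left_mono; simp)+
  then have Y2: "1/4 \<le> Y\<^sup>2" "Y\<^sup>2 \<le> 3/8" using alpha_pos by simp_all
  have Y0: "Y \<ge> 0" using alpha_pos by (simp add: Y_def y_def d_def)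
  have Yl: "1/2 \<le> Y"
    using Y2(1) Y0 power2_le_imp_le[of "1/2" Y] by (simp add: power2_eq_square)
  have Yu: "Y \<le> 5/8"
    using Y2(2) power2_le_imp_le[of Y "5/8"] by (simp add: power2_eq_square)
  have "(Y + \<alpha>)\<^sup>2 \<le> (Y + 1/7)\<^sup>2" using alpha_pos alpha_le Y0 by (intro power_mono) auto
  also have "\<dots> = Y * Y + 2/7 * Y + 1/49" by (simp add: power2_eq_square algebra_simps)
  \<comment> \<open>By convexity the square lies below its secant on
    \<open>[1/2, 5/8]\<close>.\<close>
  also have "Y * Y \<le> 9/8 * Y - 5/16"
  proof -
    have "0 \<le> (Y - 1/2) * (5/8 - Y)" using Yl Yu by (intro mult_nonneg_nonneg) auto
    also have "\<dots> = (9/8 * Y - 5/16) - Y * Y" by (simp add: field_simps)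
    finally show ?thesis by simp
  qed
  \<comment> \<open>The linear bound obtained is below \<open>- 1/20\<close> at
    \<open>Y = 1/2\<close> and has slope below 7. As \<alpha> is at most \<open>1/7\<close>, the
    right side of \<open>main\<close> then grows with slope at most 1, against 4 on the
    left.\<close>
  finally have "47/10 * (Y + \<alpha>)\<^sup>2 - 2 \<le> 7 * (Y - 1/2) - 1/20" using Yl by simp
  then have "\<alpha> * (47/10 * (Y + \<alpha>)\<^sup>2 - 2) \<le> \<alpha> * (7 * (Y - 1/2) - 1/20)"
    using alpha_pos by simp
  with main have "4 * Y - 2 \<le> \<alpha> * (7 * (Y - 1/2) - 1/20)" by (rule order_trans)
  also have "\<dots> = (7 * \<alpha>) * (Y - 1/2) - \<alpha> / 20" by (simp add: algebra_simps)
  also have "\<dots> \<le> 1 * (Y - 1/2) - \<alpha> / 20"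
    using alpha_le Yl by (intro diff_mono mult_right_mono) auto
  finally show False using Yl alpha_pos by (simp add: field_simps)
qed

end

section \<open>Normalisation and a vertex of maximum degree\<close>

theorem lemma3p14:
  fixes \<alpha> lam1 :: real and C :: "(real ^ 'r) set" and x :: "real ^ 'r \<Rightarrow> real"
  assumes "0 < \<alpha>" and "\<alpha> \<le> 1 / 7"
    and "spherical_code \<alpha> C"
    and "real (card C) \<ge>
           max ((1 / \<alpha>\<^sup>2 - 1) gchoose 2)
               (real CARD('r) + 1 / (16 * \<alpha> ^ 4) + 1 / (4 * \<alpha>\<^sup>2) + 1)"
    and "largest_eigenvalue_on C gram_matrix lam1"
    and "lam1 > (1 - \<alpha>\<^sup>2) / (2 * \<alpha>\<^sup>2)"
    and "eigenvector_on C gram_matrix lam1 x"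
    and "\<forall>u\<in>C. x u \<ge> 0"
  shows "real (max_degree (code_graph \<alpha> C)) \<le> ((1 - \<alpha>) / (2 * \<alpha>))\<^sup>2"
proof -
  define s where "s = (\<Sum>u\<in>C. (x u)\<^sup>2)"
  interpret real_code \<alpha> C by unfold_locales (use assms in auto)
  obtain i where "i \<in> C" "x i \<noteq> 0" using assms(7) by (auto simp: eigenvector_on_def)
  then have s: "s > 0" unfolding s_def using finite_code by (intro sum_pos2[of C i]) auto
  interpret nonneg_eigenvector \<alpha> C lam1 "\<lambda>u. x u / sqrt s"
  proof unfold_locales
    show "(1 / \<alpha>\<^sup>2 - 1) * (1 / \<alpha>\<^sup>2 - 2) / 2 \<le> real (card C)"
      using assms(4) by (simp add: gchoose_two)
    show "(\<Sum>v\<in>C. u \<bullet> v * (x v / sqrt s)) = lam1 * (x u / sqrt s)" if "u \<in> C" for u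
      using assms(7) that
      by (simp add: eigenvector_on_def gram_matrix_def flip: sum_divide_distrib)
    show "(\<Sum>u\<in>C. (x u / sqrt s)\<^sup>2) = 1"
      using s by (simp add: power_divide s_def flip: sum_divide_distrib)
  qed (use assms s in auto)
  let ?G = "code_graph \<alpha> C"
  have verts: "fst ?G = C" by (simp add: code_graph_def)
  have "max_degree ?G \<in> graph_degree ?G ` C"
    unfolding max_degree_def verts using finite_code code_nonempty by (intro Max_in) auto
  then obtain w where w: "w \<in> C" and k: "max_degree ?G = card (nbrs w)"
    using degree_eq by auto
  have le: "card (nbrs u) \<le> card (nbrs w)" if "u \<in> C" for u
  proof -
    have "graph_degree ?G u \<le> max_degree ?G"
      unfolding max_degree_def verts using finite_code that by (intro Max_ge) auto
    then show ?thesis using k degree_eq[OF that] by simp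
  qed
  \<comment> \<open>The ball of radius 2 has at most \<open>1 + d + d * d\<close> vertices, which is
    less than the surplus over the dimension in the cardinality hypothesis.\<close>
  define d where "d = real (card (nbrs w))"
  have d: "0 \<le> d" "d < 1 / (4 * \<alpha>\<^sup>2)" using degree_less_refined[OF w] by (auto simp: d_def)
  have "d * d \<le> (1 / (4 * \<alpha>\<^sup>2)) * (1 / (4 * \<alpha>\<^sup>2))" using d by (intro mult_mono) auto
  then have "d * d \<le> 1 / (16 * \<alpha>^4)" by (simp add: power2_eq_square power4_eq_xxxx mult_ac)
  then have "real CARD('r) + (1 + d + d * d) < real (card C)" using assms(4) d by simp
  then have "real (CARD('r) + (1 + card (nbrs w) + card (nbrs w) * card (nbrs w))) < real (card C)"
    by (simp add: d_def)
  then have "CARD('r) + (1 + card (nbrs w) + card (nbrs w) * card (nbrs w)) < card C"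
    by (simp only: of_nat_less_iff)
  then have "sqrt (card (nbrs w)) \<le> (1 - \<alpha>) / (2 * \<alpha>)"
    using degree_le_of_card[OF w le] by blast
  then have "(sqrt (card (nbrs w)))\<^sup>2 \<le> ((1 - \<alpha>) / (2 * \<alpha>))\<^sup>2"
    by (intro power_mono) auto
  then show ?thesis by (simp add: k)
qed

end
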